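(* Let $\sigma_l(x):=\frac{1}{1+e^{-x}}$ be the logistic function and $r\in\mathbb{N}$. For each abstract modulus of smoothness $\omega$ satisfying $\lim_{\delta\to0+}\omega(\delta)/\delta=\infty$ there exists $f_\omega\in C[0,1]$ such that $$\omega_r(f_\omega,\delta)=O(\omega(\delta^r))\ (\delta\to0+)\quad\text{and}\quad E(\tilde\Phi_{n,\sigma_l},f_\omega)\ne o\Big(\omega\Big(\frac{1}{n^r}\Big)\Big)\ (n\to\infty).$$
   Context: $\mathbb{N}=\{1,2,\dots\}$. The function space with uniform scaling is $$\tilde\Phi_{n,\sigma_l}:=\Big\{g:[0,1]\to\mathbb{R}:\ g(x)=\sum_{k=1}^na_k\sigma_l(Bx+c_k),\ a_k,B,c_k\in\mathbb{R}\Big\}$$ (the same $B$ for all summands of a given $g$), and $E(\tilde\Phi_{n,\sigma_l},f):=\inf\{\sup_{x\in[0,1]}|f(x)-g(x)|:g\in\tilde\Phi_{n,\sigma_l}\}$ for $f\in C[0,1]$. With $\Delta_h^rf(x):=\sum_{j=0}^r(-1)^{r-j}\binom rj f(x+jh)$, $\omega_r(f,\delta):=\sup\{|\Delta_h^rf(x)|:x\in[0,1-rh],\ 0<h\le\delta\}$ (only step sizes with $rh\le1$ contribute). An abstract modulus of smoothness is a continuous, increasing (non-decreasing) function $\omega$ on $[0,\infty)$ with $0=\omega(0)<\omega(\delta_1)\le\omega(\delta_1+\delta_2)\le\omega(\delta_1)+\omega(\delta_2)$ for all $\delta_1,\delta_2>0$. *)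

theory Defs
  imports "HOL-Analysis.Analysis" "HOL-Library.Landau_Symbols"
begin

definition logistic :: "real \<Rightarrow> real" where
  "logistic x = 1 / (1 + exp (- x))"

text \<open>Functions on the interval \<open>[0,1]\<close> are represented by total functions on the reals of which
  only the values on \<open>{0..1}\<close> matter; values elsewhere are left unconstrained.\<close>

definition uniform_scaling_space :: "nat \<Rightarrow> (real \<Rightarrow> real) \<Rightarrow> (real \<Rightarrow> real) set" where
  "uniform_scaling_space n \<sigma> =
     {g. \<exists>(a :: nat \<Rightarrow> real) (B :: real) (c :: nat \<Rightarrow> real).
           \<forall>x\<in>{0..1}. g x = (\<Sum>k=1..n. a k * \<sigma> (B * x + c k))}"

text \<open>The infimum and suprema are taken in the reals. They are genuine (all sets involved are
  nonempty and suitably bounded) whenever \<open>f\<close> is continuous on \<open>{0..1}\<close> and \<open>\<Phi>\<close> is a nonempty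
  set of functions bounded on \<open>{0..1}\<close>; this covers the spaces above for continuous \<open>\<sigma>\<close>.\<close>

definition best_approx_error :: "(real \<Rightarrow> real) set \<Rightarrow> (real \<Rightarrow> real) \<Rightarrow> real" where
  "best_approx_error \<Phi> f = (INF g\<in>\<Phi>. SUP x\<in>{0..1}. \<bar>f x - g x\<bar>)"

definition fwd_difference :: "nat \<Rightarrow> real \<Rightarrow> (real \<Rightarrow> real) \<Rightarrow> real \<Rightarrow> real" where
  "fwd_difference r h f x =
     (\<Sum>j=0..r. (-1) ^ (r - j) * real (r choose j) * f (x + real j * h))"

text \<open>Step sizes with \<open>r h > 1\<close> do not contribute, because then \<open>{0..1 - r h}\<close> is empty.\<close>

definition modulus_of_smoothness :: "nat \<Rightarrow> (real \<Rightarrow> real) \<Rightarrow> real \<Rightarrow> real" where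
  "modulus_of_smoothness r f \<delta> =
     Sup {\<bar>fwd_difference r h f x\<bar> | x h. x \<in> {0..1 - real r * h} \<and> 0 < h \<and> h \<le> \<delta>}"

definition abstract_modulus :: "(real \<Rightarrow> real) \<Rightarrow> bool" where
  "abstract_modulus \<omega> \<longleftrightarrow>
     continuous_on {0..} \<omega> \<and> mono_on {0..} \<omega> \<and> \<omega> 0 = 0 \<and>
     (\<forall>\<delta>\<^sub>1>0. \<forall>\<delta>\<^sub>2>0. 0 < \<omega> \<delta>\<^sub>1 \<and> \<omega> \<delta>\<^sub>1 \<le> \<omega> (\<delta>\<^sub>1 + \<delta>\<^sub>2) \<and> \<omega> (\<delta>\<^sub>1 + \<delta>\<^sub>2) \<le> \<omega> \<delta>\<^sub>1 + \<omega> \<delta>\<^sub>2)"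

end

theory Submission
  imports Defs
begin

text \<open>
  The function is a lacunary series \<open>f x = (\<Sum>k. A k * cos (pi * m k * x))\<close> with
  \<open>A k = \<omega> (1 / n k ^ r)\<close> and frequencies \<open>m k = (2 * r + 1) * n k\<close>, where the integers \<open>n k\<close> grow
  so fast that \<open>A k\<close> decreases geometrically while \<open>A k * m k ^ r\<close> increases geometrically.
  The second requirement can be met because \<open>\<omega> \<delta> / \<delta>\<close> is unbounded near \<open>0\<close>.

  Lower bound. Substituting \<open>y = exp (- B * x)\<close> turns a sum of \<open>N\<close> logistic functions with common
  scaling \<open>B\<close> into a rational function of \<open>y\<close> whose numerator has degree below \<open>N\<close>, so it cannot
  take alternating signs at \<open>N + 1\<close> points (\<open>logistic_sum_not_alternating\<close>). The earlier, slower terms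
  of the series hide the sign pattern of the \<open>k\<close>-th one in the values of \<open>f\<close>; the remedy is to compare \<open>r\<close>-th differences
  instead of function values. With step \<open>h = 1 / m k\<close>, the \<open>r\<close>-th difference of an element of the
  approximation space for \<open>n k\<close> is again a sum of logistic functions with the same \<open>B\<close>, now with
  \<open>n k * (r + 1)\<close> terms. On the other side, \<open>h\<close> is half a period of the \<open>k\<close>-th cosine, whose
  difference is therefore \<open>2 ^ r * A k\<close> with alternating signs at the multiples of \<open>h\<close>; the
  differences of the earlier terms are small by the growth of \<open>A k * m k ^ r\<close>, and those of the
  later ones by the decay of \<open>A k\<close> (\<open>fwd_difference_f_alternates\<close>). The sign pattern has more
  than \<open>n k * (r + 1)\<close> points, so the error of approximation is at least \<open>A k / 2\<close>
  (\<open>best_approx_error_ge\<close>).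

  Upper bound. For a step \<open>h \<le> \<delta>\<close> the series is split at the first \<open>k\<close> with \<open>\<delta> * n k \<ge> 1\<close>.
  The \<open>r\<close>-th difference of the \<open>j\<close>-th term is bounded by \<open>2 ^ r * A j\<close> from \<open>k\<close> on and by
  \<open>(pi * h * m j) ^ r * A j\<close> before. Both geometric sums are dominated by their largest term, and
  monotonicity and quasi-concavity of \<open>\<omega>\<close> bound these two terms by multiples of \<open>\<omega> (\<delta> ^ r)\<close>.
\<close>

section \<open>Sign changes of sums of logistic functions\<close>

lemma logistic_eq_rational: "logistic (B * x + c) = 1 / (1 + exp (- c) * exp (- B * x))"
  by (simp add: logistic_def flip: exp_add)

text \<open>Clearing denominators after the substitution \<open>y = exp (- B * x)\<close>. The denominator is a product of
  positive factors, so this polynomial carries all zeros of the sum.\<close>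

lemma logistic_sum_numerator:
  assumes "finite K"
  shows "\<exists>p :: real poly. (K \<noteq> {} \<longrightarrow> degree p < card K) \<and>
    (\<forall>x. (\<Sum>k\<in>K. a k * logistic (B * x + c k)) * (\<Prod>k\<in>K. 1 + exp (- c k) * exp (- B * x))
       = poly p (exp (- B * x)))"
proof (intro exI conjI impI allI)
  let ?p = "\<Sum>k\<in>K. smult (a k) (\<Prod>l\<in>K - {k}. [:1, exp (- c l):])"
  show "degree ?p < card K" if "K \<noteq> {}"
  proof -
    have "degree ?p \<le> card K - 1"
    proof (rule degree_sum_le[OF assms])
      fix k assume k: "k \<in> K"
      have "degree (\<Prod>l\<in>K - {k}. [:1, exp (- c l):]) \<le> (\<Sum>l\<in>K - {k}. degree [:1, exp (- c l):])"
        using assms by (intro degree_prod_sum_le[unfolded o_def]) auto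
      also have "\<dots> = card K - 1" using assms k by (simp add: card_Diff_singleton)
      finally show "degree (smult (a k) (\<Prod>l\<in>K - {k}. [:1, exp (- c l):])) \<le> card K - 1"
        by (meson degree_smult_le le_trans)
    qed
    moreover have "card K > 0" using assms that by (simp add: card_gt_0_iff)
    ultimately show ?thesis by linarith
  qed
  show "(\<Sum>k\<in>K. a k * logistic (B * x + c k)) * (\<Prod>k\<in>K. 1 + exp (- c k) * exp (- B * x))
       = poly ?p (exp (- B * x))" for x
  proof -
    let ?d = "\<lambda>k. 1 + exp (- c k) * exp (- B * x)"
    have d: "?d k \<noteq> 0" for k
      using add_pos_pos[of 1 "exp (- c k) * exp (- B * x)"] by (simp add: less_imp_neq)
    have "(\<Sum>k\<in>K. a k * logistic (B * x + c k)) * (\<Prod>k\<in>K. ?d k)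
        = (\<Sum>k\<in>K. a k * (\<Prod>l\<in>K - {k}. ?d l))"
      unfolding sum_distrib_right
    proof (rule sum.cong)
      fix k assume "k \<in> K"
      then have "(\<Prod>l\<in>K. ?d l) = ?d k * (\<Prod>l\<in>K - {k}. ?d l)"
        using assms by (simp add: prod.remove)
      then show "a k * logistic (B * x + c k) * (\<Prod>l\<in>K. ?d l) = a k * (\<Prod>l\<in>K - {k}. ?d l)"
        unfolding logistic_eq_rational using d[of k] by (simp del: exp_minus)
    qed simp
    also have "\<dots> = poly ?p (exp (- B * x))"
      by (simp add: poly_sum poly_prod mult.commute)
    finally show ?thesis .
  qed
qed

lemma continuous_logistic_sum:
  "continuous_on S (\<lambda>x. \<Sum>k\<in>K. a k * logistic (B * x + c k))"
proof -
  have "1 + exp t \<noteq> 0" for t :: real using exp_gt_zero[of t] by linarith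
  then show ?thesis
    unfolding logistic_def by (intro continuous_intros) auto
qed

text \<open>By the intermediate value theorem the alternation forces \<open>M\<close> zeros, which
  \<open>x \<mapsto> exp (- B * x)\<close> maps to \<open>M\<close> distinct roots of a nonzero polynomial of degree below
  \<open>card K \<le> M\<close>. The factor \<open>s\<close> leaves the sign at the first point free.\<close>

lemma logistic_sum_not_alternating:
  fixes K :: "'k set" and a c :: "'k \<Rightarrow> real" and B :: real
  defines "F \<equiv> \<lambda>x. \<Sum>k\<in>K. a k * logistic (B * x + c k)"
  assumes "finite K" "card K \<le> M" "s \<noteq> 0"
    and incr: "\<And>i. i < M \<Longrightarrow> x i < x (Suc i)"
    and alt: "\<And>i. i \<le> M \<Longrightarrow> s * (-1) ^ i * F (x i) > (0::real)"
  shows False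
proof (cases "K = {} \<or> B = 0")
  case True
  \<comment> \<open>For \<open>B = 0\<close> the substitution is not injective, but then the sum is constant.\<close>
  have "K \<noteq> {}" using alt[of 0] by (auto simp: F_def)
  with True have "B = 0" "M \<ge> 1" using assms(2,3) by (auto simp: Suc_le_eq card_gt_0_iff intro: order.strict_trans2)
  then have "F (x 0) = F (x 1)" by (simp add: F_def)
  then show False using alt[of 0] alt[of 1] \<open>M \<ge> 1\<close> by simp
next
  case False
  obtain p :: "real poly" where deg: "degree p < card K"
    and p: "\<And>x. F x * (\<Prod>k\<in>K. 1 + exp (- c k) * exp (- B * x)) = poly p (exp (- B * x))"
    using logistic_sum_numerator[OF assms(2), of a B c] False unfolding F_def by metis
  have d: "(\<Prod>k\<in>K. 1 + exp (- c k) * exp (- B * t)) \<noteq> 0" for t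
  proof -
    have "1 + exp u * exp v \<noteq> 0" for u v :: real
      using mult_pos_pos[OF exp_gt_zero[of u] exp_gt_zero[of v]] by linarith
    then show ?thesis using assms(2) by (simp del: exp_minus)
  qed
  have "\<exists>z. x i < z \<and> z < x (Suc i) \<and> F z = 0" if i: "i < M" for i
  proof -
    define G where "G = (\<lambda>t. s * (-1) ^ i * F t)"
    have "G (x i) > 0" "G (x (Suc i)) < 0"
      using alt[of i] alt[of "Suc i"] i by (auto simp: G_def)
    moreover have "continuous_on {x i..x (Suc i)} G"
      unfolding G_def F_def by (intro continuous_intros continuous_logistic_sum)
    ultimately obtain z where z: "x i \<le> z" "z \<le> x (Suc i)" "G z = 0"
      using IVT2'[of G "x (Suc i)" 0 "x i"] incr[OF i] by force
    with \<open>G (x i) > 0\<close> \<open>G (x (Suc i)) < 0\<close> have "z \<noteq> x i" "z \<noteq> x (Suc i)" by auto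
    moreover have "F z = 0" using z(3) \<open>s \<noteq> 0\<close> by (simp add: G_def)
    ultimately show ?thesis using z by (intro exI[of _ z]) auto
  qed
  then obtain z where z: "\<And>i. i < M \<Longrightarrow> x i < z i \<and> z i < x (Suc i) \<and> F (z i) = 0" by metis
  have step: "x i \<le> x j" if "i \<le> j" "j \<le> M" for i j
    using that
  proof (induction j rule: dec_induct)
    case (step k)
    then show ?case using incr[of k] by simp
  qed simp
  have "z i < z j" if "i < j" "j < M" for i j
    using z[of i] z[of j] step[of "Suc i" j] that by force
  then have inj: "inj_on z {..<M}"
    by (intro linorder_inj_onI') (auto dest: less_imp_neq)
  have "inj_on (\<lambda>i. exp (- B * z i)) {..<M}"
    using inj False by (auto simp: inj_on_def)
  then have cM: "card ((\<lambda>i. exp (- B * z i)) ` {..<M}) = M" by (simp add: card_image)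
  have "p \<noteq> 0"
  proof
    assume "p = 0"
    then have "F (x 0) = 0" using p[of "x 0"] d[of "x 0"] by simp
    then show False using alt[of 0] by simp
  qed
  have "(\<lambda>i. exp (- B * z i)) ` {..<M} \<subseteq> {y. poly p y = 0}"
  proof clarify
    fix i assume "i < M"
    then show "poly p (exp (- B * z i)) = 0" using z p[of "z i"] by simp
  qed
  then have "M \<le> card {y. poly p y = 0}"
    using card_mono[OF poly_roots_finite[OF \<open>p \<noteq> 0\<close>]] cM by metis
  then show False using card_poly_roots_bound[OF \<open>p \<noteq> 0\<close>] deg assms(3) by linarith
qed

section \<open>Forward differences\<close>

text \<open>Differences act on \<open>x \<mapsto> cis (w * x)\<close> by the multiplier \<open>(cis (w * h) - 1) ^ r\<close>.\<close>

lemma fwd_difference_cos: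
  "fwd_difference r h (\<lambda>x. cos (w * x)) x = Re (cis (w * x) * (cis (w * h) - 1) ^ r)"
proof -
  have "cis (w * x) * (cis (w * h) - 1) ^ r
      = (\<Sum>j=0..r. cis (w * x) * (of_nat (r choose j) * cis (w * h) ^ j * (-1) ^ (r - j)))"
    using binomial_ring[of "cis (w * h)" "-1" r] by (simp add: atMost_atLeast0 sum_distrib_left)
  also have "\<dots> = (\<Sum>j=0..r. of_real ((-1) ^ (r - j) * real (r choose j)) * cis (w * (x + real j * h)))"
  proof (rule sum.cong)
    fix j
    have "w * (x + real j * h) = w * x + real j * (w * h)" by (simp add: algebra_simps)
    then have "cis (w * (x + real j * h)) = cis (w * x) * cis (w * h) ^ j"
      using Complex.DeMoivre[of "w * h" j] by (simp only: cis_mult)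
    then show "cis (w * x) * (of_nat (r choose j) * cis (w * h) ^ j * (-1) ^ (r - j))
        = of_real ((-1) ^ (r - j) * real (r choose j)) * cis (w * (x + real j * h))" by simp
  qed simp
  finally show ?thesis
    by (simp add: fwd_difference_def scaleR_conv_of_real[symmetric] del: of_real_mult of_real_power)
qed

lemma abs_fwd_difference_cos_le:
  "\<bar>fwd_difference r h (\<lambda>x. cos (w * x)) x\<bar> \<le> 2 ^ r"
  "\<bar>fwd_difference r h (\<lambda>x. cos (w * x)) x\<bar> \<le> \<bar>w * h\<bar> ^ r"
proof -
  let ?n = "norm (cis (w * h) - 1)"
  have *: "\<bar>fwd_difference r h (\<lambda>x. cos (w * x)) x\<bar> \<le> ?n ^ r"
    unfolding fwd_difference_cos
    by (rule order_trans[OF abs_Re_le_cmod]) (simp add: norm_mult norm_power)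
  have n: "?n = 2 * \<bar>sin (w * h / 2)\<bar>" unfolding cis_conv_exp by (rule dist_exp_i_1)
  have "?n \<le> 2" "?n \<le> \<bar>w * h\<bar>"
    unfolding n using abs_sin_le_one[of "w * h / 2"] abs_sin_x_le_abs_x[of "w * h / 2"] by auto
  then have "?n ^ r \<le> 2 ^ r" "?n ^ r \<le> \<bar>w * h\<bar> ^ r"
    by (simp_all only: power_mono norm_ge_zero)
  with * show "\<bar>fwd_difference r h (\<lambda>x. cos (w * x)) x\<bar> \<le> 2 ^ r"
    "\<bar>fwd_difference r h (\<lambda>x. cos (w * x)) x\<bar> \<le> \<bar>w * h\<bar> ^ r" by linarith+
qed

lemma fwd_difference_cos_half_period:
  assumes "m > 0"
  shows "fwd_difference r (1 / real m) (\<lambda>x. cos (pi * real m * x)) (real i / real m)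
    = (-1) ^ r * (-1) ^ i * 2 ^ r"
proof -
  have "(-1) ^ (r - j) * real (r choose j) * cos (pi * real m * (real i / real m + real j * (1 / real m)))
     = (-1) ^ r * (-1) ^ i * real (r choose j)" if "j \<le> r" for j
  proof -
    have "pi * real m * (real i / real m + real j * (1 / real m)) = pi * real (i + j)"
      using assms by (simp add: field_simps)
    then have "cos (pi * real m * (real i / real m + real j * (1 / real m))) = (-1) ^ (i + j)"
      by (simp only: cos_npi2)
    moreover have "(-1::real) ^ r = (-1) ^ (r - j) * (-1) ^ j"
      using that by (simp flip: power_add)
    ultimately show ?thesis by (simp add: power_add)
  qed
  then have "fwd_difference r (1 / real m) (\<lambda>x. cos (pi * real m * x)) (real i / real m)
     = (-1) ^ r * (-1) ^ i * (\<Sum>j=0..r. real (r choose j))"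
    unfolding fwd_difference_def sum_distrib_left by (intro sum.cong) auto
  also have "(\<Sum>j=0..r. real (r choose j)) = 2 ^ r"
    by (simp add: choose_row_sum atMost_atLeast0[symmetric] flip: of_nat_sum)
  finally show ?thesis .
qed

lemma abs_fwd_difference_le:
  assumes "\<And>j. j \<le> r \<Longrightarrow> \<bar>u (x + real j * h)\<bar> \<le> e"
  shows "\<bar>fwd_difference r h u x\<bar> \<le> 2 ^ r * e"
proof -
  have "\<bar>fwd_difference r h u x\<bar> \<le> (\<Sum>j=0..r. real (r choose j) * e)"
    unfolding fwd_difference_def
    by (rule order_trans[OF sum_abs], rule sum_mono)
      (auto simp: abs_mult power_abs intro!: mult_left_mono assms)
  also have "\<dots> = 2 ^ r * e"
    by (simp add: choose_row_sum atMost_atLeast0[symmetric] flip: of_nat_sum sum_distrib_right)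
  finally show ?thesis .
qed

lemma fwd_difference_diff:
  "fwd_difference r h (\<lambda>t. u t - v t) x = fwd_difference r h u x - fwd_difference r h v x"
  unfolding fwd_difference_def sum_subtractf[symmetric]
  by (rule sum.cong) (simp_all only: right_diff_distrib)

text \<open>Shifting the argument only changes the offset \<open>c k\<close>, never the scaling \<open>B\<close>, so the approximation
  spaces with uniform scaling are stable under differences, at the price of a factor \<open>r + 1\<close> in the
  number of terms.\<close>

lemma fwd_difference_logistic_sum:
  "fwd_difference r h (\<lambda>t. \<Sum>k\<in>K. a k * logistic (B * t + c k)) x =
     (\<Sum>(k, j)\<in>K \<times> {0..r}. (a k * ((-1) ^ (r - j) * real (r choose j))) *
         logistic (B * x + (c k + B * real j * h)))"
proof -
  have "fwd_difference r h (\<lambda>t. \<Sum>k\<in>K. a k * logistic (B * t + c k)) x =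
     (\<Sum>j=0..r. \<Sum>k\<in>K. (a k * ((-1) ^ (r - j) * real (r choose j))) *
         logistic (B * x + (c k + B * real j * h)))"
    by (simp add: fwd_difference_def sum_distrib_left algebra_simps)
  also have "\<dots> = (\<Sum>k\<in>K. \<Sum>j=0..r. (a k * ((-1) ^ (r - j) * real (r choose j))) *
         logistic (B * x + (c k + B * real j * h)))" by (rule sum.swap)
  finally show ?thesis by (simp add: sum.cartesian_product)
qed

text \<open>If some \<open>g\<close> were closer to \<open>f\<close> than \<open>e\<close>, its \<open>r\<close>-th differences would differ from those of \<open>f\<close>
  by less than \<open>2 ^ r * e\<close> and inherit their signs at the \<open>m - r + 1\<close> points \<open>i / m\<close>; these are
  too many sign changes for a sum of \<open>n * (r + 1)\<close> logistic functions.\<close>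

lemma best_approx_error_ge:
  assumes m: "m > 0" and n: "n * (r + 1) + r \<le> m" and s: "\<bar>s\<bar> = 1"
    and bd: "\<And>x. x \<in> {0..1} \<Longrightarrow> \<bar>f x\<bar> \<le> C"
    and alt: "\<And>i. i + r \<le> m \<Longrightarrow>
       2 ^ r * e \<le> s * (-1) ^ i * fwd_difference r (1 / real m) f (real i / real m)"
  shows "e \<le> best_approx_error (uniform_scaling_space n logistic) f"
  unfolding best_approx_error_def
proof (rule cINF_greatest)
  have "(\<lambda>x. 0) \<in> uniform_scaling_space n logistic"
    unfolding uniform_scaling_space_def by (auto intro!: exI[of _ "\<lambda>_. 0"])
  then show "uniform_scaling_space n logistic \<noteq> {}" by blast
next
  fix g assume "g \<in> uniform_scaling_space n logistic"
  then obtain a B c where g: "\<And>x. x \<in> {0..1} \<Longrightarrow> g x = (\<Sum>k=1..n. a k * logistic (B * x + c k))"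
    unfolding uniform_scaling_space_def by blast
  define F where "F = (\<lambda>x. \<Sum>k=1..n. a k * logistic (B * x + c k))"
  have "\<bar>logistic t\<bar> \<le> 1" for t
    using exp_gt_zero[of "- t"] by (simp add: logistic_def add_pos_pos abs_of_pos del: exp_gt_zero)
  then have "\<bar>F x\<bar> \<le> (\<Sum>k=1..n. \<bar>a k\<bar>)" for x unfolding F_def
    by (intro order_trans[OF sum_abs] sum_mono) (auto simp: abs_mult mult_left_le)
  then have bdd: "bdd_above ((\<lambda>x. \<bar>f x - g x\<bar>) ` {0..1})"
    using bd by (intro bdd_aboveI2[of _ _ "C + (\<Sum>k=1..n. \<bar>a k\<bar>)"])
      (fastforce simp: F_def g intro: order_trans[OF abs_triangle_ineq4] add_mono)
  show "e \<le> (SUP x\<in>{0..1}. \<bar>f x - g x\<bar>)"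
  proof (rule ccontr)
    define E where "E = (SUP x\<in>{0..1}. \<bar>f x - g x\<bar>)"
    assume "\<not> ?thesis"
    then have E: "E < e" by (simp add: E_def)
    have le: "\<bar>f x - F x\<bar> \<le> E" if "x \<in> {0..1}" for x
      using cSUP_upper[OF that bdd] g[OF that] by (simp add: E_def F_def)
    let ?K = "{1..n} \<times> {0..r}"
    have pos: "s * (-1) ^ i * fwd_difference r (1 / real m) F (real i / real m) > 0"
      if i: "i + r \<le> m" for i
    proof -
      let ?D = "\<lambda>u. fwd_difference r (1 / real m) u (real i / real m)"
      have "\<bar>?D (\<lambda>t. f t - F t)\<bar> \<le> 2 ^ r * E"
      proof (rule abs_fwd_difference_le)
        fix j assume "j \<le> r"
        with i have "real i + real j \<le> real m" by linarith
        then have "real i / real m + real j * (1 / real m) \<in> {0..1}"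
          using m by (auto simp: field_simps)
        then show "\<bar>f (real i / real m + real j * (1 / real m)) - F (real i / real m + real j * (1 / real m))\<bar> \<le> E"
          by (rule le)
      qed
      also have "\<dots> < 2 ^ r * e" using E by simp
      finally have "\<bar>?D f - ?D F\<bar> < 2 ^ r * e" by (simp add: fwd_difference_diff)
      moreover have "\<bar>s * (-1) ^ i * (?D f - ?D F)\<bar> = \<bar>?D f - ?D F\<bar>"
        using s by (simp add: abs_mult power_abs)
      ultimately have "s * (-1) ^ i * ?D f - s * (-1) ^ i * ?D F < 2 ^ r * e"
        by (simp add: right_diff_distrib)
      with alt[OF i] show ?thesis by linarith
    qed
    have eq: "fwd_difference r (1 / real m) F x = (\<Sum>kj\<in>?K.
        (case kj of (k, j) \<Rightarrow> a k * ((-1) ^ (r - j) * real (r choose j))) *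
        logistic (B * x + (case kj of (k, j) \<Rightarrow> c k + B * real j * (1 / real m))))" for x
      unfolding F_def fwd_difference_logistic_sum by (simp add: case_prod_unfold)
    show False
    proof (rule logistic_sum_not_alternating[of ?K "m - r" s "\<lambda>i. real i / real m"])
      show "card ?K \<le> m - r" using n by simp
      show "0 < s * (-1) ^ i * (\<Sum>kj\<in>?K.
        (case kj of (k, j) \<Rightarrow> a k * ((-1) ^ (r - j) * real (r choose j))) *
        logistic (B * (real i / real m) + (case kj of (k, j) \<Rightarrow> c k + B * real j * (1 / real m))))"
        if "i \<le> m - r" for i
        unfolding eq[symmetric] using that n by (intro pos) simp
      show "real i / real m < real (Suc i) / real m" for i
        using m by (simp add: divide_strict_right_mono)
    qed (use s in auto)
  qed
qed

section \<open>Lacunary cosine series\<close>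

text \<open>The ratio \<open>4 ^ Suc r\<close> in \<open>growth\<close> exceeds \<open>pi ^ r\<close> by enough to make the \<open>r\<close>-th differences of all
  earlier terms together small compared with the \<open>k\<close>-th amplitude at step \<open>1 / m k\<close>.\<close>

locale lacunary_cosine_series =
  fixes r :: nat and A :: "nat \<Rightarrow> real" and m :: "nat \<Rightarrow> nat"
  assumes A_pos: "0 < A k"
    and A_decay: "A (Suc k) \<le> A k / 4"
    and m_pos: "0 < m k"
    and growth: "4 ^ Suc r * (A k * real (m k) ^ r) \<le> A (Suc k) * real (m (Suc k)) ^ r"
begin

definition f :: "real \<Rightarrow> real" where
  "f x = (\<Sum>k. A k * cos (pi * real (m k) * x))"

lemma A_geometric: "A (i + k) \<le> A k * (1 / 4) ^ i"
proof (induction i)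
  case (Suc i)
  then show ?case using A_decay[of "i + k"] by simp
qed simp

lemma summable_A: "summable (\<lambda>i. A (i + k))"
  by (rule summable_comparison_test'[of "\<lambda>i. A k * (1 / 4) ^ i" 0])
    (use A_geometric[of _ k] A_pos in \<open>auto intro!: summable_mult simp: less_imp_le\<close>)

lemma tail_le: "(\<Sum>i. A (i + k)) \<le> 4 / 3 * A k"
proof -
  have "(\<Sum>i. A (i + k)) \<le> (\<Sum>i. A k * (1 / 4) ^ i)"
    by (intro suminf_le A_geometric summable_A summable_mult summable_geometric) simp
  also have "\<dots> = 4 / 3 * A k" by (subst suminf_mult) (auto simp: suminf_geometric)
  finally show ?thesis .
qed

lemma head_le: "3 * 4 ^ r * (\<Sum>j<k. A j * real (m j) ^ r) \<le> A k * real (m k) ^ r"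
proof (induction k)
  case 0
  show ?case using A_pos[of 0] by simp
next
  case (Suc k)
  let ?S = "\<Sum>j<k. A j * real (m j) ^ r" and ?b = "A k * real (m k) ^ r"
  have "?b \<ge> 0" using A_pos[of k] by simp
  then have "?b \<le> 4 ^ r * ?b" by (simp add: mult_le_cancel_right1)
  then have "3 * 4 ^ r * ?S \<le> 4 ^ r * ?b" using Suc by linarith
  then have "3 * 4 ^ r * (?S + ?b) \<le> 4 ^ Suc r * ?b"
    unfolding distrib_left power_Suc by linarith
  also note growth[of k]
  finally show ?case by simp
qed

lemma term_bound: "norm (A k * cos (pi * real (m k) * x)) \<le> A k"
proof -
  have "norm (A k * cos (pi * real (m k) * x)) = A k * \<bar>cos (pi * real (m k) * x)\<bar>"
    using A_pos[of k] by (simp only: real_norm_def abs_mult abs_of_pos)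
  also have "\<dots> \<le> A k * 1"
    using A_pos[of k] by (intro mult_left_mono abs_cos_le_one less_imp_le)
  finally show ?thesis by simp
qed

lemma summable_terms: "summable (\<lambda>k. A k * cos (pi * real (m k) * x))"
proof (rule summable_comparison_test')
  show "summable A" using summable_A[of 0] by simp
qed (rule term_bound)

lemma abs_f_le: "\<bar>f x\<bar> \<le> suminf A"
proof -
  have "norm (\<Sum>k. A k * cos (pi * real (m k) * x)) \<le> suminf A"
    using summable_A[of 0] by (intro norm_suminf_le term_bound) simp
  then show ?thesis by (simp only: f_def real_norm_def)
qed

lemma continuous_f: "continuous_on S f"
proof -
  have "uniform_limit S (\<lambda>n x. \<Sum>k<n. A k * cos (pi * real (m k) * x)) f sequentially"
    unfolding f_def using summable_A[of 0]
    by (intro Weierstrass_m_test[where M = A]) (auto intro: term_bound[unfolded real_norm_def])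
  then show ?thesis
    by (rule uniform_limit_theorem[rotated]) (auto intro!: continuous_intros always_eventually)
qed

definition term_difference :: "real \<Rightarrow> real \<Rightarrow> nat \<Rightarrow> real" where
  "term_difference h x k = A k * fwd_difference r h (\<lambda>x. cos (pi * real (m k) * x)) x"

lemma term_difference_sums: "term_difference h x sums fwd_difference r h f x"
proof -
  have "(\<lambda>k. \<Sum>j=0..r. (-1) ^ (r - j) * real (r choose j) * (A k * cos (pi * real (m k) * (x + real j * h))))
      sums fwd_difference r h f x"
    unfolding fwd_difference_def f_def
    by (intro sums_sum sums_mult summable_sums summable_terms)
  then show ?thesis
    by (simp add: term_difference_def[abs_def] fwd_difference_def sum_distrib_left mult_ac)
qed

lemma abs_term_difference_le:
  "\<bar>term_difference h x k\<bar> \<le> 2 ^ r * A k"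
  "\<bar>term_difference h x k\<bar> \<le> \<bar>pi * h\<bar> ^ r * (A k * real (m k) ^ r)"
proof -
  note b = abs_fwd_difference_cos_le[of r h "pi * real (m k)" x]
  show "\<bar>term_difference h x k\<bar> \<le> 2 ^ r * A k"
    using mult_left_mono[OF b(1), of "A k"] A_pos[of k] by (simp add: term_difference_def abs_mult mult.commute)
  show "\<bar>term_difference h x k\<bar> \<le> \<bar>pi * h\<bar> ^ r * (A k * real (m k) ^ r)"
    using mult_left_mono[OF b(2), of "A k"] A_pos[of k]
    by (simp add: term_difference_def abs_mult power_mult_distrib mult_ac)
qed

lemma term_difference_head:
  "\<bar>\<Sum>j<k. term_difference h x j\<bar> \<le> \<bar>pi * h\<bar> ^ r * (\<Sum>j<k. A j * real (m j) ^ r)"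
  unfolding sum_distrib_left by (rule order_trans[OF sum_abs]) (intro sum_mono abs_term_difference_le)

lemma term_difference_tail: "\<bar>\<Sum>i. term_difference h x (i + k)\<bar> \<le> 2 ^ r * (4 / 3 * A k)"
proof -
  have "\<bar>\<Sum>i. term_difference h x (i + k)\<bar> \<le> (\<Sum>i. 2 ^ r * A (i + k))"
    unfolding real_norm_def[symmetric]
    by (rule norm_suminf_le)
      (simp_all only: real_norm_def abs_term_difference_le summable_mult summable_A)
  also have "\<dots> = 2 ^ r * (\<Sum>i. A (i + k))" by (rule suminf_mult[OF summable_A])
  also have "\<dots> \<le> 2 ^ r * (4 / 3 * A k)" by (intro mult_left_mono tail_le) simp
  finally show ?thesis .
qed

lemma fwd_difference_split:
  "fwd_difference r h f x = (\<Sum>i. term_difference h x (i + k)) + (\<Sum>j<k. term_difference h x j)"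
  using suminf_split_initial_segment[OF sums_summable[OF term_difference_sums]]
    sums_unique[OF term_difference_sums] by metis

lemma abs_fwd_difference_f_le:
  "\<bar>fwd_difference r h f x\<bar> \<le> 2 ^ r * (4 / 3 * A k) + \<bar>pi * h\<bar> ^ r * (\<Sum>j<k. A j * real (m j) ^ r)"
  unfolding fwd_difference_split[of h x k]
  by (rule order_trans[OF abs_triangle_ineq]) (intro add_mono term_difference_head term_difference_tail)

text \<open>At step \<open>1 / m k\<close> the \<open>k\<close>-th term contributes \<open>2 ^ r * A k\<close> in absolute value, the earlier terms
  together at most \<open>A k / 3 \<le> 2 ^ r * (A k / 6)\<close>, using \<open>r \<ge> 1\<close>, and the later ones at most
  \<open>2 ^ r * (A k / 3)\<close>. Half of the main contribution survives.\<close>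

lemma fwd_difference_f_alternates:
  assumes "r \<ge> 1"
  shows "2 ^ r * (A k / 2) \<le>
    (-1) ^ r * (-1) ^ i * fwd_difference r (1 / real (m k)) f (real i / real (m k))"
proof -
  let ?h = "1 / real (m k)" and ?x = "real i / real (m k)"
  let ?H = "\<Sum>j<k. term_difference ?h ?x j" and ?T = "\<Sum>i. term_difference ?h ?x (i + Suc k)"
  have mk: "real (m k) > 0" using m_pos by simp
  have H: "\<bar>?H\<bar> \<le> A k / 3"
  proof -
    have "\<bar>?H\<bar> \<le> \<bar>pi * ?h\<bar> ^ r * (\<Sum>j<k. A j * real (m j) ^ r)" by (rule term_difference_head)
    also have "\<dots> = pi ^ r * (\<Sum>j<k. A j * real (m j) ^ r) / real (m k) ^ r"
      by (simp add: power_divide)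
    also have "\<dots> \<le> 4 ^ r * (\<Sum>j<k. A j * real (m j) ^ r) / real (m k) ^ r"
      using pi_less_4 A_pos
      by (intro divide_right_mono mult_right_mono power_mono sum_nonneg)
        (auto simp: less_imp_le)
    also have "\<dots> \<le> A k / 3" using head_le[of k] mk by (simp add: field_simps)
    finally show ?thesis .
  qed
  have "\<bar>?T\<bar> \<le> 2 ^ r * (4 / 3 * A (Suc k))" by (rule term_difference_tail)
  also have "\<dots> \<le> 2 ^ r * (A k / 3)" using A_decay[of k] by simp
  finally have T: "\<bar>?T\<bar> \<le> 2 ^ r * (A k / 3)" .
  define u :: real where "u = (-1) ^ r * (-1) ^ i"
  have u: "u * u = 1" "\<bar>u\<bar> = 1"
    unfolding u_def by (simp_all add: abs_mult power_abs flip: power_add)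
  have "term_difference ?h ?x k = u * (2 ^ r * A k)"
    unfolding term_difference_def fwd_difference_cos_half_period[OF m_pos] u_def by simp
  then have "fwd_difference r ?h f ?x = u * (2 ^ r * A k) + (?T + ?H)"
    unfolding fwd_difference_split[of ?h ?x "Suc k"] by simp
  then have "u * fwd_difference r ?h f ?x = 2 ^ r * A k + u * (?T + ?H)"
    using u(1) by (simp add: distrib_left flip: mult.assoc)
  moreover have "\<bar>u * (?T + ?H)\<bar> \<le> 2 ^ r * (A k / 3) + A k / 3"
    using H T u(2) unfolding abs_mult by simp
  moreover have "A k / 3 \<le> 2 ^ r * (A k / 6)"
    using A_pos[of k] power_increasing[OF assms, of "2::real"] by simp
  ultimately show ?thesis unfolding u_def[symmetric] by linarith
qed

end

section \<open>Abstract moduli of smoothness\<close>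

lemma abstract_modulus_nat_mult:
  assumes "abstract_modulus \<omega>" "t > 0"
  shows "\<omega> (real (Suc n) * t) \<le> real (Suc n) * \<omega> t"
proof (induction n)
  case (Suc n)
  have "\<omega> (real (Suc n) * t + t) \<le> \<omega> (real (Suc n) * t) + \<omega> t"
    using assms unfolding abstract_modulus_def by simp
  with Suc show ?case by (simp add: algebra_simps)
qed simp

text \<open>The quotient \<open>\<omega> t / t\<close> is decreasing up to a factor \<open>2\<close>: subadditivity handles integer
  multiples of \<open>t\<close>, and rounding \<open>s / t \<ge> 1\<close> up to an integer at most doubles it.\<close>

lemma abstract_modulus_quasi_concave:
  assumes \<omega>: "abstract_modulus \<omega>" and "0 < t" "t \<le> s"
  shows "t * \<omega> s \<le> 2 * s * \<omega> t"
proof -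
  define n where "n = nat \<lfloor>s / t\<rfloor>"
  have st: "s / t \<ge> 1" using assms by simp
  have n: "real n \<le> s / t" "s / t \<le> real (Suc n)" using st unfolding n_def by linarith+
  have "\<omega> s \<le> \<omega> (real (Suc n) * t)"
    using \<omega> n(2) assms unfolding abstract_modulus_def
    by (auto simp: field_simps elim!: mono_onD)
  also have "\<dots> \<le> real (Suc n) * \<omega> t" by (rule abstract_modulus_nat_mult[OF \<omega> \<open>0 < t\<close>])
  also have "\<dots> \<le> (2 * (s / t)) * \<omega> t"
  proof (rule mult_right_mono)
    show "real (Suc n) \<le> 2 * (s / t)" using n(1) st by linarith
    show "0 \<le> \<omega> t" using \<omega> \<open>0 < t\<close> unfolding abstract_modulus_def by (meson less_imp_le)
  qed
  finally show ?thesis using \<open>0 < t\<close> by (simp add: field_simps)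
qed

text \<open>For fixed \<open>n k\<close> both requirements on \<open>n (Suc k)\<close> hold for all large integers:
  \<open>\<omega> (1 / n ^ r)\<close> tends to \<open>0\<close> by continuity, and \<open>\<omega> (1 / n ^ r) * n ^ r\<close> is the quotient
  \<open>\<omega> \<delta> / \<delta>\<close> at \<open>\<delta> = 1 / n ^ r\<close>. Starting at \<open>1\<close> ensures that every \<open>\<delta> < 1\<close> satisfies
  \<open>\<delta> * n k < 1\<close> for at least one \<open>k\<close>.\<close>

lemma resonance_indices:
  assumes r: "r \<ge> 1" and \<omega>: "abstract_modulus \<omega>"
    and lim: "filterlim (\<lambda>\<delta>. \<omega> \<delta> / \<delta>) at_top (at_right 0)"
  defines "a \<equiv> \<lambda>n. \<omega> (1 / real n ^ r)"
  shows "\<exists>n :: nat \<Rightarrow> nat. strict_mono n \<and> n 0 = 1 \<and>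
    (\<forall>k. a (n (Suc k)) \<le> a (n k) / 4 \<and>
         4 ^ Suc r * (a (n k) * real (n k) ^ r) \<le> a (n (Suc k)) * real (n (Suc k)) ^ r)"
proof -
  have "filterlim (\<lambda>n. real n ^ r) at_top sequentially"
    using r by (intro filterlim_pow_at_top filterlim_real_sequentially) auto
  from filterlim_compose[OF filterlim_inverse_at_right_top this]
  have right: "filterlim (\<lambda>n. 1 / real n ^ r) (at_right 0) sequentially"
    by (simp add: inverse_eq_divide)
  from filterlim_compose[OF lim right]
  have top: "filterlim (\<lambda>n. a n * real n ^ r) at_top sequentially"
    by (simp add: a_def)
  have "(\<lambda>n. 1 / real n ^ r) \<longlonglongrightarrow> 0"
    using right by (simp add: filterlim_at)
  then have zero: "a \<longlonglongrightarrow> 0"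
    unfolding a_def using \<omega> continuous_on_tendsto_compose[of "{0..}" \<omega> "\<lambda>n. 1 / real n ^ r" 0 sequentially]
    by (auto simp: abstract_modulus_def)
  have a_pos: "a n > 0" if "n > 0" for n
    using \<omega> that unfolding a_def abstract_modulus_def
    by (metis of_nat_0_less_iff zero_less_divide_1_iff zero_less_power)
  have "\<exists>n. n 0 = 1 \<and> (\<forall>k. 0 < n k \<and> (n k < n (Suc k) \<and> a (n (Suc k)) \<le> a (n k) / 4 \<and>
         4 ^ Suc r * (a (n k) * real (n k) ^ r) \<le> a (n (Suc k)) * real (n (Suc k)) ^ r))"
  proof -
    have ex: "\<exists>n'. 0 < n' \<and> n < n' \<and> a n' \<le> a n / 4 \<and>
         4 ^ Suc r * (a n * real n ^ r) \<le> a n' * real n' ^ r" if "0 < n" for n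
    proof -
      have "\<forall>\<^sub>F n' in sequentially. a n' < a n / 4"
        using order_tendstoD(2)[OF zero, of "a n / 4"] a_pos[OF that] by simp
      moreover have "\<forall>\<^sub>F n' in sequentially. 4 ^ Suc r * (a n * real n ^ r) \<le> a n' * real n' ^ r"
        using top unfolding filterlim_at_top by blast
      moreover note eventually_gt_at_top[of n]
      ultimately have "\<forall>\<^sub>F n' in sequentially. 0 < n' \<and> n < n' \<and> a n' \<le> a n / 4 \<and>
         4 ^ Suc r * (a n * real n ^ r) \<le> a n' * real n' ^ r"
        by eventually_elim auto
      then show ?thesis by (rule eventually_happens'[OF sequentially_bot])
    qed
    define P where "P = (\<lambda>(k::nat) n::nat. 0 < n \<and> (k = 0 \<longrightarrow> n = 1))"
    define Q where "Q = (\<lambda>(k::nat) n n'. n < n' \<and> a n' \<le> a n / 4 \<and>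
         4 ^ Suc r * (a n * real n ^ r) \<le> a n' * real n' ^ r)"
    have "\<exists>n. \<forall>k. P k (n k) \<and> Q k (n k) (n (Suc k))"
      by (rule dependent_nat_choice) (use ex in \<open>auto simp: P_def Q_def\<close>)
    then show ?thesis unfolding P_def Q_def by blast
  qed
  then show ?thesis by (auto simp: strict_mono_Suc_iff)
qed

theorem corollary4p5:
  fixes r :: nat and \<omega> :: "real \<Rightarrow> real"
  assumes "r \<ge> 1"
    and "abstract_modulus \<omega>"
    and "filterlim (\<lambda>\<delta>. \<omega> \<delta> / \<delta>) at_top (at_right 0)"
  shows "\<exists>f :: real \<Rightarrow> real. continuous_on {0..1} f \<and>
           (\<lambda>\<delta>. modulus_of_smoothness r f \<delta>) \<in> O[at_right 0](\<lambda>\<delta>. \<omega> (\<delta> ^ r)) \<and>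
           (\<lambda>n. best_approx_error (uniform_scaling_space n logistic) f)
             \<notin> o[sequentially](\<lambda>n. \<omega> (1 / real n ^ r))"
proof -
  have \<omega>_pos: "\<omega> t > 0" if "t > 0" for t
    using assms(2) that unfolding abstract_modulus_def by blast
  have \<omega>_mono: "\<omega> s \<le> \<omega> t" if "0 \<le> s" "s \<le> t" for s t
    using assms(2) that unfolding abstract_modulus_def by (auto elim!: mono_onD)
  obtain n :: "nat \<Rightarrow> nat" where n: "strict_mono n" "n 0 = 1"
    and decay: "\<And>k. \<omega> (1 / real (n (Suc k)) ^ r) \<le> \<omega> (1 / real (n k) ^ r) / 4"
    and growth: "\<And>k. 4 ^ Suc r * (\<omega> (1 / real (n k) ^ r) * real (n k) ^ r)
       \<le> \<omega> (1 / real (n (Suc k)) ^ r) * real (n (Suc k)) ^ r"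
    using resonance_indices[OF assms] by blast
  have n_pos: "n k > 0" for k
    using n strict_mono_less_eq[OF n(1), of 0 k] by simp
  define A where "A = (\<lambda>k. \<omega> (1 / real (n k) ^ r))"
  \<comment> \<open>With frequency \<open>q * n\<close> there are \<open>q * n - r \<ge> n * (r + 1)\<close> sign changes, as many as needed.\<close>
  define q where "q = 2 * r + 1"
  interpret lacunary_cosine_series r A "\<lambda>k. q * n k"
  proof
    show "4 ^ Suc r * (A k * real (q * n k) ^ r) \<le> A (Suc k) * real (q * n (Suc k)) ^ r" for k
      using mult_left_mono[OF growth[of k], of "real q ^ r"]
      by (simp add: A_def power_mult_distrib mult_ac)
  qed (use decay n_pos \<omega>_pos in \<open>auto simp: A_def q_def\<close>)
  define C where "C = 2 ^ r * (4 / 3) + pi ^ r * (4 * real q ^ r)"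

  have diff: "\<bar>fwd_difference r h f x\<bar> \<le> C * \<omega> (\<delta> ^ r)"
    if h: "0 < h" "h \<le> \<delta>" and \<delta>: "\<delta> < 1" for h \<delta> x
  proof -
    have \<delta>0: "\<delta> > 0" using h by linarith
    \<comment> \<open>From \<open>k\<close> on the amplitudes are at most \<open>\<omega> (\<delta> ^ r)\<close>; before \<open>k\<close> the step is shorter than \<open>1 / n\<close>.\<close>
    define k where "k = (LEAST k. 1 \<le> \<delta> * real (n k))"
    obtain N :: nat where N: "1 / \<delta> \<le> real N" using real_arch_simple by blast
    have "real N \<le> real (n N)" using seq_suble[OF n(1), of N] by simp
    with N have "1 / \<delta> \<le> real (n N)" by linarith
    with \<delta>0 have ex: "1 \<le> \<delta> * real (n N)" by (simp add: field_simps)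
    then have k: "1 \<le> \<delta> * real (n k)" unfolding k_def by (rule LeastI)
    have least: "\<delta> * real (n j) < 1" if "j < k" for j
      using not_less_Least[of j "\<lambda>k. 1 \<le> \<delta> * real (n k)"] that unfolding k_def by simp
    have "k \<noteq> 0" using k n(2) \<delta> by (metis mult.right_neutral not_le of_nat_1)
    then obtain j where j: "k = Suc j" by (cases k) auto
    have "1 \<le> (\<delta> * real (n k)) ^ r" using k by simp
    then have "1 / real (n k) ^ r \<le> \<delta> ^ r"
      using n_pos[of k] by (simp add: power_mult_distrib field_simps)
    then have Ak: "A k \<le> \<omega> (\<delta> ^ r)" unfolding A_def by (intro \<omega>_mono) auto
    have "(\<delta> * real (n j)) ^ r \<le> 1" using least[of j] j \<delta>0 by (intro power_le_one) auto
    then have "\<delta> ^ r \<le> 1 / real (n j) ^ r"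
      using n_pos[of j] by (simp add: power_mult_distrib field_simps)
    then have "\<delta> ^ r * A j \<le> 2 * (1 / real (n j) ^ r) * \<omega> (\<delta> ^ r)"
      unfolding A_def using \<delta>0 by (intro abstract_modulus_quasi_concave[OF assms(2)]) auto
    then have Aj: "\<delta> ^ r * (A j * real (n j) ^ r) \<le> 2 * \<omega> (\<delta> ^ r)"
      using n_pos[of j] by (simp add: field_simps)
    let ?b = "A j * real (q * n j) ^ r"
    have b0: "?b \<ge> 0" using A_pos[of j] by simp
    have A0: "(\<Sum>i<j. A i * real (q * n i) ^ r) \<ge> 0"
      using A_pos by (intro sum_nonneg mult_nonneg_nonneg zero_le_power) (simp_all add: less_imp_le)
    have "(\<Sum>i<j. A i * real (q * n i) ^ r) \<le> 3 * 4 ^ r * (\<Sum>i<j. A i * real (q * n i) ^ r)"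
    proof -
      have "(1::real) \<le> 3 * 4 ^ r" using one_le_power[of "4::real" r] by linarith
      from mult_right_mono[OF this A0] show ?thesis by simp
    qed
    also note head_le[of j]
    finally have S: "(\<Sum>i<k. A i * real (q * n i) ^ r) \<le> 2 * ?b" by (simp add: j)
    have "\<bar>fwd_difference r h f x\<bar>
        \<le> 2 ^ r * (4 / 3 * A k) + \<bar>pi * h\<bar> ^ r * (\<Sum>i<k. A i * real (q * n i) ^ r)"
      by (rule abs_fwd_difference_f_le)
    also have "\<dots> \<le> 2 ^ r * (4 / 3 * \<omega> (\<delta> ^ r)) + (pi * \<delta>) ^ r * (2 * ?b)"
      using Ak S h b0 A_pos
      by (intro add_mono mult_left_mono mult_mono power_mono sum_nonneg mult_nonneg_nonneg zero_le_power)
        (simp_all add: abs_mult less_imp_le)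
    also have "(pi * \<delta>) ^ r * (2 * ?b) = pi ^ r * (2 * real q ^ r * (\<delta> ^ r * (A j * real (n j) ^ r)))"
      by (simp add: power_mult_distrib mult_ac)
    also have "\<dots> \<le> pi ^ r * (2 * real q ^ r * (2 * \<omega> (\<delta> ^ r)))"
      using Aj by (intro mult_left_mono) auto
    finally show ?thesis by (simp add: C_def algebra_simps)
  qed

  have "\<bar>modulus_of_smoothness r f \<delta>\<bar> \<le> C * \<bar>\<omega> (\<delta> ^ r)\<bar>"
    if \<delta>: "0 < \<delta>" "\<delta> < 1 / real (Suc r)" for \<delta>
  proof -
    let ?S = "{\<bar>fwd_difference r h f x\<bar> | x h. x \<in> {0..1 - real r * h} \<and> 0 < h \<and> h \<le> \<delta>}"
    have "\<delta> * real (Suc r) < 1" using \<delta> by (simp add: field_simps)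
    then have "\<delta> * real r + \<delta> < 1" by (simp add: distrib_left)
    moreover have "0 \<le> \<delta> * real r" using \<delta> by simp
    ultimately have r\<delta>: "real r * \<delta> < 1" "\<delta> < 1"
      unfolding mult.commute[of "real r"] using \<delta> by linarith+
    have mem: "\<bar>fwd_difference r \<delta> f 0\<bar> \<in> ?S"
      using \<delta> r\<delta> by (intro CollectI exI[of _ 0] exI[of _ \<delta>]) auto
    have le: "y \<le> C * \<omega> (\<delta> ^ r)" if "y \<in> ?S" for y
      using that diff r\<delta> by auto
    have "Sup ?S \<le> C * \<omega> (\<delta> ^ r)" using mem le by (intro cSup_least) auto
    moreover have "0 \<le> Sup ?S"
      using cSup_upper[OF mem bdd_aboveI[OF le]] by linarith
    ultimately show ?thesis
      using \<omega>_pos[of "\<delta> ^ r"] \<delta> by (simp add: modulus_of_smoothness_def)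
  qed
  then have big: "(\<lambda>\<delta>. modulus_of_smoothness r f \<delta>) \<in> O[at_right 0](\<lambda>\<delta>. \<omega> (\<delta> ^ r))"
    by (intro bigoI[of _ C]) (auto simp: eventually_at_right_field intro!: exI[of _ "1 / real (Suc r)"])

  have lower: "A k / 2 \<le> best_approx_error (uniform_scaling_space (n k) logistic) f" for k
  proof (rule best_approx_error_ge[where s = "(-1) ^ r" and C = "suminf A"])
    show "n k * (r + 1) + r \<le> q * n k"
      using mult_le_mono2[of 1 "n k" r] n_pos[of k] by (simp add: q_def algebra_simps)
    show "2 ^ r * (A k / 2)
       \<le> (-1) ^ r * (-1) ^ i * fwd_difference r (1 / real (q * n k)) f (real i / real (q * n k))" for i
      by (rule fwd_difference_f_alternates[OF assms(1)])
  qed (use m_pos abs_f_le in \<open>auto simp: power_abs\<close>)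
  have "(\<lambda>n. best_approx_error (uniform_scaling_space n logistic) f)
             \<notin> o[sequentially](\<lambda>n. \<omega> (1 / real n ^ r))"
  proof
    assume "(\<lambda>n. best_approx_error (uniform_scaling_space n logistic) f)
             \<in> o[sequentially](\<lambda>n. \<omega> (1 / real n ^ r))"
    from landau_o.smallD[OF this, of "1 / 4"]
    obtain N where N: "\<And>i. i \<ge> N \<Longrightarrow>
        \<bar>best_approx_error (uniform_scaling_space i logistic) f\<bar> \<le> 1 / 4 * \<bar>\<omega> (1 / real i ^ r)\<bar>"
      by (auto simp: eventually_sequentially)
    have "\<bar>best_approx_error (uniform_scaling_space (n N) logistic) f\<bar> \<le> 1 / 4 * \<bar>A N\<bar>"
      using N[OF seq_suble[OF n(1), of N]] unfolding A_def .
    with lower[of N] A_pos[of N] show False by linarith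
  qed
  with big continuous_f show ?thesis by blast
qed

end
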